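(* Let $\ell\ge 1$ be a fixed integer, let $\rho\in[0,1/2)$, and let $r=r(n)$ be a sequence of non-negative integers such that $r/n\to\rho$ as $n\to\infty$. Then $$\lim_{n\to\infty}\frac1n\log_2 M_r^{(\le \ell)}(n)=1-h(\rho).$$
   Context: Let $\mathbb{F}=\{0,1\}$ and let $\mathbb{F}^n$ be the binary Hamming space (hypercube), with Hamming distance $d(x,y)$ = number of coordinates in which $x$ and $y$ differ. For $x\in\mathbb{F}^n$ put $B_r(x)=\{y\in\mathbb{F}^n: d(x,y)\le r\}$, and for $X\subseteq\mathbb{F}^n$ put $B_r(X)=\bigcup_{x\in X}B_r(x)$. A code is a nonempty subset $C\subseteq\mathbb{F}^n$; write $I_r(C;X)=B_r(X)\cap C$ (so $I_r(C;\emptyset)=\emptyset$). For non-negative integers $r,\ell$, a code $C\subseteq\mathbb{F}^n$ is $(r,\le\ell)$-identifying if $I_r(C;X)\ne I_r(C;Y)$ for all $X,Y\subseteq\mathbb{F}^n$ with $|X|\le\ell$, $|Y|\le\ell$ and $X\neq Y$ (the empty set is allowed as $X$ or $Y$). $M_r^{(\le\ell)}(n)$ denotes the smallest possible cardinality of an $(r,\le\ell)$-identifying code in $\mathbb{F}^n$; the assertion includes that such codes exist for all sufficiently large $n$. $h(x)=-x\log_2 x-(1-x)\log_2(1-x)$ is the binary entropy function, with $h(0)=0$. *)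

theory Defs
  imports Complex_Main
begin

text \<open>The binary Hamming space of dimension \<open>n\<close>; a point is the list of its \<open>n\<close> coordinates.\<close>

definition cube :: "nat \<Rightarrow> bool list set" where
  "cube n = {x. length x = n}"

text \<open>Only used for words of equal length.\<close>

definition hamming_dist :: "bool list \<Rightarrow> bool list \<Rightarrow> nat" where
  "hamming_dist x y = card {i. i < length x \<and> x ! i \<noteq> y ! i}"

definition hamming_ball :: "nat \<Rightarrow> nat \<Rightarrow> bool list \<Rightarrow> bool list set" where
  "hamming_ball n r x = {y \<in> cube n. hamming_dist x y \<le> r}"

definition hamming_nbhd :: "nat \<Rightarrow> nat \<Rightarrow> bool list set \<Rightarrow> bool list set" where
  "hamming_nbhd n r X = (\<Union>x\<in>X. hamming_ball n r x)"

definition is_code :: "nat \<Rightarrow> bool list set \<Rightarrow> bool" where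
  "is_code n C \<longleftrightarrow> C \<subseteq> cube n \<and> C \<noteq> {}"

definition I_set :: "nat \<Rightarrow> nat \<Rightarrow> bool list set \<Rightarrow> bool list set \<Rightarrow> bool list set" where
  "I_set n r C X = hamming_nbhd n r X \<inter> C"

definition identifying :: "nat \<Rightarrow> nat \<Rightarrow> nat \<Rightarrow> bool list set \<Rightarrow> bool" where
  "identifying n r l C \<longleftrightarrow> is_code n C \<and>
     (\<forall>X Y. X \<subseteq> cube n \<and> Y \<subseteq> cube n \<and> card X \<le> l \<and> card Y \<le> l \<and> X \<noteq> Y
        \<longrightarrow> I_set n r C X \<noteq> I_set n r C Y)"

text \<open>The value is meaningful only if an identifying code exists.\<close>

definition min_identifying :: "nat \<Rightarrow> nat \<Rightarrow> nat \<Rightarrow> nat" where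
  "min_identifying n r l = (LEAST m. \<exists>C. identifying n r l C \<and> card C = m)"

text \<open>The convention \<open>h(0) = 0\<close> holds because the factor \<open>x\<close> vanishes at \<open>0\<close>.\<close>

definition binary_entropy :: "real \<Rightarrow> real" where
  "binary_entropy x = - x * log 2 x - (1 - x) * log 2 (1 - x)"

lemma binary_entropy_0: "binary_entropy 0 = 0"
  by (simp add: binary_entropy_def)

end

theory Submission
  imports Defs "HOL-Real_Asymp.Real_Asymp"
begin

text \<open>
  Separating \<open>{x}\<close> from \<open>{}\<close> makes an identifying code a covering code, so the sphere covering bound
  gives the lower estimate. Conversely, a code is identifying as soon as it meets every set
  \<open>B\<^sub>r(x) - B\<^sub>r(Y)\<close> with \<open>|Y| \<le> l\<close> and \<open>x \<notin> Y\<close>. Flipping \<open>x\<close> on an \<open>r\<close>-set \<open>S\<close> gives a point of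
  this set whenever \<open>S\<close> contains less than half of each support \<open>T\<close> in which \<open>x\<close> differs from a
  \<open>y \<in> Y\<close>; since \<open>\<rho> < 1/2\<close>, a positive fraction of the \<open>r\<close>-subsets of all but boundedly many
  coordinates has this property. So all these sets have size \<open>2 ^ (n (h(\<rho>) - o(1)))\<close>, and as there are
  only \<open>2 ^ O(n)\<close> of them, a greedy hitting set of size \<open>2 ^ (n (1 - h(\<rho>) + o(1)))\<close> exists.
\<close>

section \<open>Subsets of prescribed size\<close>

lemma card_subsets_avoiding:
  assumes "finite M" "A \<subseteq> M"
  shows "card {S. S \<subseteq> M \<and> card S = r \<and> S \<inter> A = {}} = (card M - card A) choose r"
proof -
  have "{S. S \<subseteq> M \<and> card S = r \<and> S \<inter> A = {}} = {S. S \<subseteq> M - A \<and> card S = r}"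
    by auto
  then show ?thesis
    using assms by (simp add: n_subsets card_Diff_subset finite_subset)
qed

text \<open>For a uniformly random \<open>r\<close>-subset \<open>S\<close> of \<open>M\<close>, the
  number of points of \<open>T\<close> missed by \<open>S\<close> is hypergeometric with mean
  \<open>p * t\<close>. The events \<open>a \<notin> S\<close> are negatively correlated, so the
  variance is at most the sum of their probabilities. Everything is kept as a sum over
  \<open>F\<close>, scaled by the number of \<open>r\<close>-subsets.\<close>

lemma variance_card_Diff_subsets:
  fixes M T :: "'a set" and r :: nat
  defines "F \<equiv> {S. S \<subseteq> M \<and> card S = r}"
  defines "m \<equiv> real (card M)" and "t \<equiv> real (card T)"
  defines "p \<equiv> (m - r) / m"
  assumes M: "finite M" "T \<subseteq> M" and r: "r \<le> card M"
  shows "(\<Sum>S\<in>F. (real (card (T - S)) - p * t)\<^sup>2) \<le> p * t * real (card M choose r)"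
proof (cases "card M = 0 \<or> T = {}")
  case True
  with M show ?thesis by (auto simp: t_def)
next
  case False
  define B where "B = real (card M choose r)"
  have finT: "finite T" using M finite_subset by blast
  have finF: "finite F" unfolding F_def using M by simp
  have cF: "real (card F) = B" unfolding F_def B_def using M by (simp add: n_subsets)
  have m1: "m \<ge> 1" using False by (simp add: m_def)
  have t1: "t \<ge> 1" using False finT by (simp add: t_def Suc_le_eq card_gt_0_iff)
  have p0: "p \<ge> 0" using r m1 by (simp add: p_def m_def)
  have one: "real (card {S\<in>F. a \<notin> S}) = p * B" if "a \<in> T" for a
  proof -
    have "{S\<in>F. a \<notin> S} = {S. S \<subseteq> M \<and> card S = r \<and> S \<inter> {a} = {}}" by (auto simp: F_def)
    then have "card {S\<in>F. a \<notin> S} = (card M - 1) choose r"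
      using card_subsets_avoiding[of M "{a}" r] M that by auto
    moreover have "(card M - r) * (card M choose r) = card M * ((card M - 1) choose r)"
      by (rule binomial_absorb_comp)
    then have "(m - r) * B = m * real ((card M - 1) choose r)"
      unfolding m_def B_def using r by (metis of_nat_diff of_nat_mult)
    ultimately show ?thesis using m1 by (simp add: p_def field_simps)
  qed
  \<comment> \<open>Negative correlation: missing both \<open>a\<close> and \<open>b\<close> has
    probability at most \<open>p\<^sup>2\<close>.\<close>
  have two: "real (card {S\<in>F. a \<notin> S \<and> b \<notin> S}) \<le> p\<^sup>2 * B" if "a \<in> T" "b \<in> T" "a \<noteq> b" for a b
  proof -
    have "{S\<in>F. a \<notin> S \<and> b \<notin> S} = {S. S \<subseteq> M \<and> card S = r \<and> S \<inter> {a, b} = {}}"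
      by (auto simp: F_def)
    moreover have ab: "{a, b} \<subseteq> M" using M that by blast
    ultimately have c: "card {S\<in>F. a \<notin> S \<and> b \<notin> S} = (card M - 2) choose r"
      using card_subsets_avoiding[OF M(1) ab, of r] \<open>a \<noteq> b\<close> by (simp add: numeral_2_eq_2)
    have "card {a, b} \<le> card M" by (rule card_mono[OF M(1) ab])
    then have m2: "card M \<ge> 2" using that by simp
    show ?thesis
    \<comment> \<open>Split off because \<open>card M - 1 - r\<close>, used in the other case, would
      be a truncated difference.\<close>
    proof (cases "r = card M")
      case True
      then have "(card M - 2) choose r = 0" using m2 by (simp add: binomial_eq_0)
      then show ?thesis by (simp only: c) (simp add: B_def)
    next
      case False
      then have r': "r \<le> card M - 1" using r by simp
      have "(card M - r) * (card M choose r) = card M * ((card M - 1) choose r)"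
        by (rule binomial_absorb_comp)
      then have e1: "(m - r) * B = m * real ((card M - 1) choose r)"
        unfolding m_def B_def using r by (metis of_nat_diff of_nat_mult)
      have "(card M - 1 - r) * ((card M - 1) choose r) = (card M - 1) * ((card M - 2) choose r)"
        using binomial_absorb_comp[of "card M - 1" r] by (simp add: numeral_2_eq_2)
      then have "real (card M - 1 - r) * real ((card M - 1) choose r)
          = real (card M - 1) * real ((card M - 2) choose r)"
        by (metis of_nat_mult)
      then have e2: "(m - 1 - r) * real ((card M - 1) choose r) = (m - 1) * real ((card M - 2) choose r)"
        using r' m2 by (simp add: m_def of_nat_diff diff_diff_eq)
      have mm: "m \<ge> 2" using m2 by (simp add: m_def)
      have e3: "real ((card M - 1) choose r) = p * B"
        using e1 mm by (simp add: p_def field_simps)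
      have "real ((card M - 2) choose r) = (m - 1 - r) / (m - 1) * real ((card M - 1) choose r)"
        using e2 mm by (simp add: field_simps)
      also have "\<dots> \<le> p * (p * B)"
        unfolding e3
      proof (rule mult_right_mono)
        show "(m - 1 - r) / (m - 1) \<le> p"
          using mm by (simp add: p_def divide_simps) (simp add: algebra_simps)
      qed (use p0 in \<open>simp add: B_def\<close>)
      finally have "real ((card M - 2) choose r) \<le> p * (p * B)" .
      then show ?thesis by (simp add: c power2_eq_square)
    qed
  qed
  have Z: "real (card (T - S)) = (\<Sum>a\<in>T. of_bool (a \<notin> S))" for S
    using finT by (simp add: Diff_eq Collect_neg_eq)
  have sum1: "(\<Sum>S\<in>F. real (card (T - S))) = t * (p * B)"
  proof -
    have "(\<Sum>S\<in>F. real (card (T - S))) = (\<Sum>a\<in>T. \<Sum>S\<in>F. of_bool (a \<notin> S))"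
      unfolding Z by (rule sum.swap)
    also have "\<dots> = (\<Sum>a\<in>T. real (card {S\<in>F. a \<notin> S}))"
      using finF by (intro sum.cong refl) (simp add: Int_def)
    also have "\<dots> = (\<Sum>a\<in>T. p * B)" by (intro sum.cong refl one)
    finally show ?thesis by (simp add: t_def)
  qed
  have sum2: "(\<Sum>S\<in>F. (real (card (T - S)))\<^sup>2) \<le> t * (p * B) + t\<^sup>2 * (p\<^sup>2 * B)"
  proof -
    have "(\<Sum>S\<in>F. (real (card (T - S)))\<^sup>2)
        = (\<Sum>S\<in>F. \<Sum>a\<in>T. \<Sum>b\<in>T. of_bool (a \<notin> S \<and> b \<notin> S))"
      unfolding Z power2_eq_square sum_product by (intro sum.cong refl) auto
    also have "\<dots> = (\<Sum>a\<in>T. \<Sum>b\<in>T. \<Sum>S\<in>F. of_bool (a \<notin> S \<and> b \<notin> S))"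
      by (subst sum.swap) (intro sum.cong refl sum.swap)
    also have "\<dots> = (\<Sum>a\<in>T. \<Sum>b\<in>T. real (card {S\<in>F. a \<notin> S \<and> b \<notin> S}))"
      using finF by (intro sum.cong refl) (simp add: Int_def)
    \<comment> \<open>The diagonal terms also receive \<open>p\<^sup>2 * B\<close>; this
      overestimate makes the quadratic terms cancel exactly once the square around the mean is
      expanded.\<close>
    also have "\<dots> \<le> (\<Sum>a\<in>T. \<Sum>b\<in>T. (if b = a then p * B else 0) + p\<^sup>2 * B)"
    proof (intro sum_mono)
      fix a b assume "a \<in> T" "b \<in> T"
      then show "real (card {S\<in>F. a \<notin> S \<and> b \<notin> S}) \<le> (if b = a then p * B else 0) + p\<^sup>2 * B"
        using one[of a] two[of a b] by (auto simp: B_def)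
    qed
    also have "\<dots> = t * (p * B) + t\<^sup>2 * (p\<^sup>2 * B)"
      using finT by (simp add: sum.distrib t_def power2_eq_square algebra_simps)
    finally show ?thesis .
  qed
  have "(\<Sum>S\<in>F. (real (card (T - S)) - p * t)\<^sup>2)
     = (\<Sum>S\<in>F. (real (card (T - S)))\<^sup>2 - 2 * (p * t) * real (card (T - S)) + (p * t)\<^sup>2)"
    by (intro sum.cong refl) (simp add: power2_diff)
  also have "\<dots> = (\<Sum>S\<in>F. (real (card (T - S)))\<^sup>2) - 2 * (p * t) * (t * (p * B)) + (p * t)\<^sup>2 * B"
    by (simp add: sum.distrib sum_subtractf cF flip: sum1 sum_distrib_left)
  also have "\<dots> \<le> p * t * B"
    using sum2 by (simp add: power2_eq_square algebra_simps)
  finally show ?thesis by (simp add: B_def)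
qed

text \<open>Chebyshev's inequality: each counted \<open>S\<close> deviates from the mean by at least
  \<open>t * \<delta>\<close>, while the total squared deviation is at most \<open>t\<close> times
  the number of \<open>r\<close>-subsets. \<open>T\<close> may stick out of \<open>M\<close>, since
  \<open>M\<close> will arise by deleting coordinates; only \<open>T \<inter> M\<close> is
  random.\<close>

lemma card_unbalanced_subsets:
  fixes M T :: "'a set" and r :: nat and \<delta> :: real
  assumes M: "finite M" "M \<noteq> {}" and T: "finite T" "T \<noteq> {}" and \<delta>: "\<delta> > 0"
    and r: "real r \<le> (1 / 2 - \<delta>) * real (card M)"
  shows "real (card {S. S \<subseteq> M \<and> card S = r \<and> card T \<le> 2 * card (S \<inter> T)}) * (real (card T) * \<delta>\<^sup>2)
    \<le> real (card M choose r)"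
proof -
  define F where "F = {S. S \<subseteq> M \<and> card S = r}"
  define G where "G = {S. S \<subseteq> M \<and> card S = r \<and> card T \<le> 2 * card (S \<inter> T)}"
  define m where "m = real (card M)"
  define p where "p = (m - r) / m"
  define t where "t = real (card T)"
  define t' where "t' = real (card (T \<inter> M))"
  have m0: "m > 0" using M by (simp add: m_def card_gt_0_iff)
  have t0: "t > 0" using T by (simp add: t_def card_gt_0_iff)
  have tt: "t' \<le> t" using T by (simp add: t_def t'_def card_mono)
  have rm: "real r \<le> m"
  proof -
    have "(1 / 2 - \<delta>) * m \<le> 1 * m" using \<delta> m0 by (intro mult_right_mono) auto
    then show ?thesis using r by (simp add: m_def)
  qed
  have p: "p \<ge> 1 / 2 + \<delta>" "p \<le> 1"
    using r m0 by (auto simp: p_def m_def[symmetric] field_simps)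
  \<comment> \<open>If \<open>S\<close> contains at least half of \<open>T\<close>, it misses at
    most \<open>t' - t / 2\<close> points of \<open>T \<inter> M\<close>. The mean is
    \<open>p * t'\<close>, and \<open>1 - p \<le> 1 / 2 - \<delta>\<close> makes the gap at least
    \<open>t * \<delta>\<close>.\<close>
  have dev: "(t * \<delta>)\<^sup>2 \<le> (real (card (T \<inter> M - S)) - p * t')\<^sup>2" if "S \<in> G" for S
  proof -
    have "S \<subseteq> M" "t \<le> 2 * real (card (S \<inter> T))" using that by (auto simp: G_def t_def)
    moreover have "card (T \<inter> M) = card (T \<inter> M - S) + card (S \<inter> T)"
    proof -
      have "T \<inter> M = (T \<inter> M - S) \<union> (S \<inter> T)" using \<open>S \<subseteq> M\<close> by auto
      then have "card (T \<inter> M) = card ((T \<inter> M - S) \<union> (S \<inter> T))" by simp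
      also have "\<dots> = card (T \<inter> M - S) + card (S \<inter> T)"
        using T by (intro card_Un_disjoint) auto
      finally show ?thesis .
    qed
    ultimately have "real (card (T \<inter> M - S)) \<le> t' - t / 2" by (simp add: t'_def)
    moreover have "(1 - p) * t' \<le> (1 / 2 - \<delta>) * t"
      using p tt t0 by (intro mult_mono) (auto simp: t'_def)
    ultimately have "t * \<delta> \<le> p * t' - real (card (T \<inter> M - S))" by (simp add: algebra_simps)
    then have "(t * \<delta>)\<^sup>2 \<le> (p * t' - real (card (T \<inter> M - S)))\<^sup>2"
      using t0 \<delta> by (intro power_mono) auto
    then show ?thesis by (simp add: power2_commute)
  qed
  have "real (card G) * (t * \<delta>)\<^sup>2 = (\<Sum>S\<in>G. (t * \<delta>)\<^sup>2)" by simp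
  also have "\<dots> \<le> (\<Sum>S\<in>G. (real (card (T \<inter> M - S)) - p * t')\<^sup>2)"
    by (rule sum_mono[OF dev])
  also have "\<dots> \<le> (\<Sum>S\<in>F. (real (card (T \<inter> M - S)) - p * t')\<^sup>2)"
    using M by (intro sum_mono2) (auto simp: F_def G_def)
  also have "\<dots> \<le> p * t' * real (card M choose r)"
    using variance_card_Diff_subsets[of M "T \<inter> M" r] M rm
    by (simp add: F_def p_def m_def t'_def)
  also have "\<dots> \<le> 1 * t * real (card M choose r)"
    using p tt t0 by (intro mult_right_mono mult_mono) (auto simp: t'_def)
  finally have "t * (real (card G) * (t * \<delta>\<^sup>2)) \<le> t * real (card M choose r)"
    by (simp add: power2_eq_square mult_ac)
  then show ?thesis using t0 by (simp add: G_def t_def)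
qed

text \<open>Supports of size at most \<open>K\<close> are avoided altogether, at the cost of \<open>l * K\<close> coordinates;
  the larger ones are controlled by Chebyshev's inequality.\<close>

lemma card_balanced_subsets:
  fixes \<T> :: "nat set set" and \<delta> :: real
  assumes \<T>: "finite \<T>" "card \<T> \<le> l" "\<And>T. T \<in> \<T> \<Longrightarrow> T \<subseteq> {..<n} \<and> T \<noteq> {}"
    and \<delta>: "\<delta> > 0" and K: "2 * real l \<le> real K * \<delta>\<^sup>2" and n: "l * K < n"
    and r: "real r \<le> (1 / 2 - \<delta>) * real (n - l * K)"
  shows "real ((n - l * K) choose r) / 2
    \<le> real (card {S. S \<subseteq> {..<n} \<and> card S = r \<and> (\<forall>T\<in>\<T>. 2 * card (S \<inter> T) < card T)})"
proof -
  define U where "U = \<Union>{T\<in>\<T>. card T \<le> K}"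
  define L where "L = {T\<in>\<T>. K < card T}"
  have finL: "finite L" using \<T> by (simp add: L_def)
  have cL: "card L \<le> l" using card_mono[of \<T> L] \<T> by (auto simp: L_def)
  have "card U \<le> (\<Sum>T\<in>{T\<in>\<T>. card T \<le> K}. card T)" unfolding U_def
    by (rule card_Union_le_sum_card)
  also have "\<dots> \<le> (\<Sum>T\<in>{T\<in>\<T>. card T \<le> K}. K)" by (intro sum_mono) auto
  also have "\<dots> \<le> l * K"
    using card_mono[of \<T> "{T\<in>\<T>. card T \<le> K}"] \<T> by simp
  finally have cU: "card U \<le> l * K" .
  have Un: "U \<subseteq> {..<n}" using \<T> by (auto simp: U_def)
  then have "n - l * K \<le> card ({..<n} - U)"
    using cU by (simp add: card_Diff_subset finite_subset)
  \<comment> \<open>\<open>M\<close> is trimmed to exactly \<open>n - l * K\<close> points, so that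
    the final bound does not depend on the family.\<close>
  then obtain M where M: "M \<subseteq> {..<n} - U" "card M = n - l * K" "finite M"
    using obtain_subset_with_card_n by (metis finite_Diff finite_lessThan finite_subset)
  define F where "F = {S. S \<subseteq> M \<and> card S = r}"
  define bad where "bad T = {S. S \<subseteq> M \<and> card S = r \<and> card T \<le> 2 * card (S \<inter> T)}" for T
  define B where "B = real ((n - l * K) choose r)"
  have finF: "finite F" using M by (simp add: F_def)
  have Mne: "M \<noteq> {}" using M(2) n by auto
  \<comment> \<open>By the choice of \<open>K\<close>, each large support spoils at most a fraction
    \<open>1 / (2 * l)\<close> of the \<open>r\<close>-subsets of \<open>M\<close>; summed over at
    most \<open>l\<close> supports this is at most one half.\<close>
  have bad: "real (card (bad T)) * (2 * l) \<le> B" if "T \<in> L" for T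
  proof -
    have T: "finite T" "T \<noteq> {}" "K < card T" using that \<T> finite_subset by (auto simp: L_def)
    have "2 * real l \<le> real K * \<delta>\<^sup>2" by (rule K)
    also have "\<dots> \<le> real (card T) * \<delta>\<^sup>2" using T by (intro mult_right_mono) auto
    finally have "real (card (bad T)) * (2 * l) \<le> real (card (bad T)) * (real (card T) * \<delta>\<^sup>2)"
      by (intro mult_left_mono) auto
    also have "\<dots> \<le> B"
      using card_unbalanced_subsets[of M T \<delta> r] M Mne T \<delta> r by (simp add: bad_def B_def)
    finally show ?thesis .
  qed
  have badU: "real (card (\<Union>T\<in>L. bad T)) \<le> B / 2"
  \<comment> \<open>The union bound divides by \<open>2 * l\<close>; for \<open>l = 0\<close> the
    family \<open>L\<close> is empty.\<close>
  proof (cases "l = 0")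
    case True
    then show ?thesis using cL finL by (simp add: B_def)
  next
    case False
    have "real (card (\<Union>T\<in>L. bad T)) \<le> real (\<Sum>T\<in>L. card (bad T))"
      using card_UN_le[OF finL] of_nat_le_iff by blast
    also have "\<dots> = (\<Sum>T\<in>L. real (card (bad T)))" by simp
    also have "\<dots> \<le> (\<Sum>T\<in>L. B / (2 * l))"
      using bad False by (intro sum_mono) (simp add: field_simps)
    also have "\<dots> = real (card L) * (B / (2 * l))" by simp
    also have "\<dots> \<le> real l * (B / (2 * l))"
      using cL by (intro mult_right_mono) (auto simp: B_def)
    finally show ?thesis using False by simp
  qed
  have "F - (\<Union>T\<in>L. bad T)
      \<subseteq> {S. S \<subseteq> {..<n} \<and> card S = r \<and> (\<forall>T\<in>\<T>. 2 * card (S \<inter> T) < card T)}"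
  proof (rule subsetI, intro CollectI conjI ballI)
    fix S assume S: "S \<in> F - (\<Union>T\<in>L. bad T)"
    show "S \<subseteq> {..<n}" "card S = r" using S M by (auto simp: F_def)
    fix T assume T: "T \<in> \<T>"
    show "2 * card (S \<inter> T) < card T"
    proof (cases "T \<in> L")
      case True
      then show ?thesis using S by (auto simp: F_def bad_def)
    next
      case False
      \<comment> \<open>A small support lies in the deleted part, so \<open>S\<close> misses it, and
        the strict inequality holds because \<open>T\<close> is nonempty.\<close>
      then have "T \<subseteq> U" using T by (auto simp: L_def U_def)
      then have "S \<inter> T = {}" using S M by (auto simp: F_def)
      moreover have "card T > 0" using \<T>(3)[OF T] finite_subset by (auto simp: card_gt_0_iff)
      ultimately show ?thesis by simp
    qed
  qed
  then have "card (F - (\<Union>T\<in>L. bad T)) 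
      \<le> card {S. S \<subseteq> {..<n} \<and> card S = r \<and> (\<forall>T\<in>\<T>. 2 * card (S \<inter> T) < card T)}"
    by (rule card_mono[rotated]) simp
  moreover have "card F = (n - l * K) choose r" using M by (simp add: F_def n_subsets)
  moreover have "card F - card (\<Union>T\<in>L. bad T) \<le> card (F - (\<Union>T\<in>L. bad T))"
    by (rule diff_card_le_card_Diff) (use finL M in \<open>auto simp: bad_def\<close>)
  ultimately show ?thesis using badU by (simp add: B_def)
qed

section \<open>Hitting sets\<close>

text \<open>Counting incidences of points with the sets not yet hit shows that some point lies in at
  least a fraction \<open>s / card \<Omega>\<close> of them; adding it shrinks their number by the
  factor \<open>1 - s / card \<Omega>\<close>. The size bound is an inequality because the chosen
  point may already lie in \<open>C\<close>.\<close>

lemma greedy_hitting_set: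
  fixes \<F> :: "'a set set" and s :: real
  assumes \<Omega>: "finite \<Omega>" "\<Omega> \<noteq> {}" and \<F>: "finite \<F>"
    and s: "\<And>A. A \<in> \<F> \<Longrightarrow> A \<subseteq> \<Omega> \<and> s \<le> real (card A)"
  shows "\<exists>C\<subseteq>\<Omega>. card C \<le> t \<and>
    real (card {A\<in>\<F>. A \<inter> C = {}}) \<le> real (card \<F>) * (1 - s / real (card \<Omega>)) ^ t"
proof (induction t)
  case 0
  show ?case by (intro exI[of _ "{}"]) simp
next
  case (Suc t)
  then obtain C where C: "C \<subseteq> \<Omega>" "card C \<le> t"
    and le: "real (card {A\<in>\<F>. A \<inter> C = {}}) \<le> real (card \<F>) * (1 - s / real (card \<Omega>)) ^ t"
    by auto
  define G where "G = {A\<in>\<F>. A \<inter> C = {}}"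
  define N where "N = real (card \<Omega>)"
  have N: "N > 0" using \<Omega> by (simp add: N_def card_gt_0_iff)
  have finG: "finite G" using \<F> by (simp add: G_def)
  show ?case
  \<comment> \<open>A member of the family yields \<open>s \<le> N\<close>, so that the factor
    \<open>1 - s / N\<close> is nonnegative and the induction hypothesis may be multiplied by
    it.\<close>
  proof (cases "\<F> = {}")
    case True
    then show ?thesis by (intro exI[of _ "{}"]) simp
  next
    case False
    then obtain A0 where "A0 \<in> \<F>" by auto
    then have "s \<le> N" using s[of A0] card_mono[of \<Omega> A0] \<Omega> by (simp add: N_def)
    have "\<exists>w\<in>\<Omega>. real (card G) * s / N \<le> real (card {A\<in>G. w \<in> A})"
    proof (rule ccontr)
      assume "\<not> ?thesis"
      then have "(\<Sum>w\<in>\<Omega>. real (card {A\<in>G. w \<in> A})) < (\<Sum>w\<in>\<Omega>. real (card G) * s / N)"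
        using \<Omega> by (intro sum_strict_mono) auto
      also have "\<dots> = (\<Sum>A\<in>G. s)" using N by (simp add: N_def)
      also have "\<dots> \<le> (\<Sum>A\<in>G. real (card A))" using s by (intro sum_mono) (auto simp: G_def)
      also have "\<dots> = (\<Sum>A\<in>G. \<Sum>w\<in>\<Omega>. of_bool (w \<in> A))"
        using s \<Omega> by (intro sum.cong) (auto simp: G_def Int_absorb1)
      also have "\<dots> = (\<Sum>w\<in>\<Omega>. \<Sum>A\<in>G. of_bool (w \<in> A))" by (rule sum.swap)
      also have "\<dots> = (\<Sum>w\<in>\<Omega>. real (card {A\<in>G. w \<in> A}))"
        using finG by (intro sum.cong) (auto simp: Int_def)
      finally show False by simp
    qed
    then obtain w where w: "w \<in> \<Omega>" "real (card G) * s / N \<le> real (card {A\<in>G. w \<in> A})" by auto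
    have "{A\<in>\<F>. A \<inter> insert w C = {}} = G - {A\<in>G. w \<in> A}" by (auto simp: G_def)
    moreover have "card (G - {A\<in>G. w \<in> A}) = card G - card {A\<in>G. w \<in> A}"
      using finG by (intro card_Diff_subset) auto
    moreover have "card {A\<in>G. w \<in> A} \<le> card G" using finG by (intro card_mono) auto
    ultimately have "real (card {A\<in>\<F>. A \<inter> insert w C = {}}) = real (card G) - real (card {A\<in>G. w \<in> A})"
      by simp
    also have "\<dots> \<le> real (card G) * (1 - s / N)" using w by (simp add: algebra_simps)
    also have "\<dots> \<le> real (card \<F>) * (1 - s / N) ^ t * (1 - s / N)"
      using le \<open>s \<le> N\<close> N by (intro mult_right_mono) (auto simp: G_def N_def)
    finally show ?thesis
      using w C card_insert_le_m1[of "Suc t" C w]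
      by (intro exI[of _ "insert w C"]) (auto simp: N_def mult_ac card_insert_if)
  qed
qed

text \<open>After slightly more than \<open>N / s * ln f\<close> greedy steps, where
  \<open>N = card \<Omega>\<close> and \<open>f = card \<F>\<close>, fewer than
  \<open>f * exp (- ln f) = 1\<close> sets remain unhit, hence none.\<close>

lemma hitting_set_exists:
  fixes \<F> :: "'a set set" and s :: real
  assumes \<Omega>: "finite \<Omega>" "\<Omega> \<noteq> {}" and \<F>: "finite \<F>" "\<F> \<noteq> {}" and "s > 0"
    and s: "\<And>A. A \<in> \<F> \<Longrightarrow> A \<subseteq> \<Omega> \<and> s \<le> real (card A)"
  shows "\<exists>C\<subseteq>\<Omega>. (\<forall>A\<in>\<F>. A \<inter> C \<noteq> {}) \<and>
    real (card C) \<le> real (card \<Omega>) / s * (ln (real (card \<F>)) + 1)"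
proof -
  define N where "N = real (card \<Omega>)"
  define f where "f = real (card \<F>)"
  have N: "N > 0" using \<Omega> by (simp add: N_def card_gt_0_iff)
  have f: "f \<ge> 1" using \<F> by (simp add: f_def Suc_le_eq card_gt_0_iff)
  obtain A0 where "A0 \<in> \<F>" using \<F> by auto
  then have sN: "s \<le> N" using s[of A0] card_mono[of \<Omega> A0] \<Omega> by (simp add: N_def)
  \<comment> \<open>The successor of the floor makes \<open>t\<close> strictly larger than
    \<open>N / s * ln f\<close>, so the count of unhit sets falls strictly below
    \<open>1\<close>.\<close>
  define t where "t = Suc (nat \<lfloor>N / s * ln f\<rfloor>)"
  have nn: "N / s * ln f \<ge> 0" using N f \<open>s > 0\<close> by simp
  have t1: "N / s * ln f < real t" unfolding t_def using nn by linarith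
  have t2: "real t \<le> N / s * ln f + 1" unfolding t_def using nn by linarith
  obtain C where C: "C \<subseteq> \<Omega>" "card C \<le> t" 
    and le: "real (card {A\<in>\<F>. A \<inter> C = {}}) \<le> f * (1 - s / N) ^ t"
    using greedy_hitting_set[OF \<Omega> \<F>(1) s, of t] by (auto simp: N_def f_def)
  have "(1 - s / N) ^ t \<le> exp (- (s / N)) ^ t"
    using exp_ge_add_one_self[of "- (s / N)"] sN N by (intro power_mono) auto
  also have "\<dots> = exp (- (s / N * real t))" by (simp add: exp_of_nat_mult[symmetric] mult_ac)
  also have "\<dots> < exp (- ln f)"
    using t1 N \<open>s > 0\<close> by (simp add: field_simps)
  also have "\<dots> = 1 / f" using f by (simp add: exp_minus inverse_eq_divide)
  finally have "f * (1 - s / N) ^ t < 1" using f by (simp add: field_simps)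
  then have "card {A\<in>\<F>. A \<inter> C = {}} = 0" using le by linarith
  then have "\<forall>A\<in>\<F>. A \<inter> C \<noteq> {}" using \<F> by auto
  moreover have "real (card C) \<le> N / s * (ln f + 1)"
  proof -
    \<comment> \<open>This absorbs the rounding error \<open>1\<close> into the summand
      \<open>N / s\<close>.\<close>
    have "1 \<le> N / s" using sN \<open>s > 0\<close> by simp
    then have "N / s * ln f + 1 \<le> N / s * (ln f + 1)" by (simp add: algebra_simps)
    then show ?thesis using t2 C(2) by linarith
  qed
  ultimately show ?thesis using C by (auto simp: N_def f_def)
qed

section \<open>Exponential size of binomial coefficients\<close>

text \<open>This says that \<open>r ^ k / fact k\<close> is largest at \<open>k = r\<close>. For
  \<open>k \<le> r\<close> the quotient \<open>fact r / fact k\<close> is a product of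
  \<open>r - k\<close> factors that are at most \<open>r\<close>; for \<open>k > r\<close> the
  quotient \<open>fact k / fact r\<close> is a product of \<open>k - r\<close> factors that exceed
  \<open>r\<close>.\<close>

lemma fact_mult_power_le: "fact r * r ^ k \<le> (fact k * r ^ r :: nat)"
proof (cases "k \<le> r")
  case True
  then have "fact r \<le> fact k * r ^ (r - k)"
  proof (induction "r - k" arbitrary: k)
    case (Suc d)
    then have d: "r - k = Suc (r - Suc k)" by simp
    have "fact r \<le> fact (Suc k) * r ^ (r - Suc k)"
      by (rule Suc.hyps(1)) (use Suc.hyps(2) in linarith)+
    also have "\<dots> = fact k * (Suc k * r ^ (r - Suc k))" by (simp add: algebra_simps)
    also have "\<dots> \<le> fact k * (r * r ^ (r - Suc k))" using Suc by (intro mult_mono) auto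
    also have "r * r ^ (r - Suc k) = r ^ (r - k)"
      unfolding d by simp
    finally show ?case .
  qed simp
  then have "fact r * r ^ k \<le> fact k * r ^ (r - k) * r ^ k" by (rule mult_right_mono) simp
  also have "\<dots> = fact k * r ^ r" using True by (simp flip: power_add)
  finally show ?thesis .
next
  case False
  then have "r \<le> k" by simp
  then have "fact r * r ^ (k - r) \<le> (fact k :: nat)"
  proof (induction k rule: dec_induct)
    case (step k)
    have "fact r * r ^ (Suc k - r) = r * (fact r * r ^ (k - r))"
      using step by (simp add: Suc_diff_le)
    also have "\<dots> \<le> Suc k * fact k" using step by (intro mult_mono) auto
    finally show ?case by simp
  qed simp
  then have "fact r * r ^ (k - r) * r ^ r \<le> fact k * r ^ r" by (rule mult_right_mono) simp
  then show ?thesis using \<open>r \<le> k\<close> by (simp add: mult.assoc flip: power_add)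
qed

text \<open>In the expansion of \<open>(r + (m - r)) ^ m\<close> the term with index \<open>r\<close> is the largest.\<close>

lemma binomial_term_le:
  assumes "r \<le> m" "k \<le> m"
  shows "(m choose k) * r ^ k * (m - r) ^ (m - k) \<le> (m choose r) * r ^ r * (m - r) ^ (m - r)"
proof -
  \<comment> \<open>After multiplication by \<open>fact r * fact (m - r)\<close>, the previous lemma
    applies to \<open>r\<close> and to \<open>m - r\<close> separately. The product
    \<open>fact k * fact (m - k) * (m choose k)\<close> is \<open>fact m\<close>, hence the same for
    \<open>k\<close> and \<open>r\<close>.\<close>
  have "fact r * fact (m - r) * ((m choose k) * r ^ k * (m - r) ^ (m - k))
      = (m choose k) * (fact r * r ^ k) * (fact (m - r) * (m - r) ^ (m - k))"
    by (simp add: mult_ac)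
  also have "\<dots> \<le> (m choose k) * (fact k * r ^ r) * (fact (m - k) * (m - r) ^ (m - r))"
    by (intro mult_mono le_refl fact_mult_power_le) auto
  also have "\<dots> = fact k * fact (m - k) * (m choose k) * r ^ r * (m - r) ^ (m - r)"
    by (simp add: mult_ac)
  also have "\<dots> = fact r * fact (m - r) * (m choose r) * r ^ r * (m - r) ^ (m - r)"
    using assms by (simp only: binomial_fact_lemma)
  finally have "(fact r * fact (m - r)) * ((m choose k) * r ^ k * (m - r) ^ (m - k))
      \<le> (fact r * fact (m - r)) * ((m choose r) * r ^ r * (m - r) ^ (m - r))"
    by (simp add: mult_ac)
  then show ?thesis by (subst (asm) mult_le_cancel1) simp
qed

text \<open>At \<open>k = 0\<close> both sides vanish, as \<open>0 ^ 0 = 1\<close>; this lets the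
  extreme cases \<open>r = 0\<close> and \<open>r = m\<close> join the entropy computation.\<close>

lemma log_power_self: "log 2 (real k ^ k) = real k * log 2 (real k)"
  by (cases "k = 0") (simp_all add: log_nat_power)

text \<open>The binomial expansion of \<open>(r + (m - r)) ^ m\<close> has \<open>m + 1\<close>
  terms, the largest being \<open>P\<close>, so \<open>P\<close> lies between
  \<open>m ^ m / (m + 1)\<close> and \<open>m ^ m\<close>. Dividing by
  \<open>r ^ r * (m - r) ^ (m - r)\<close> and taking logarithms turns \<open>m ^ m\<close> into
  \<open>m\<close> times the entropy of \<open>r / m\<close>.\<close>

lemma log_binomial_bounds:
  assumes "r \<le> m" "m > 0"
  shows "\<bar>log 2 (real (m choose r)) - real m * binary_entropy (real r / real m)\<bar> \<le> log 2 (real m + 1)"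
proof -
  define P where "P = (m choose r) * r ^ r * (m - r) ^ (m - r)"
  have P0: "P > 0" using assms by (simp add: P_def) linarith
  have ex: "m ^ m = (\<Sum>k\<le>m. (m choose k) * r ^ k * (m - r) ^ (m - k))"
    using binomial[of r "m - r" m] assms by simp
  have "P \<le> m ^ m" unfolding ex P_def
    by (rule member_le_sum[of r "{..m}" "\<lambda>k. (m choose k) * r ^ k * (m - r) ^ (m - k)"]) (use assms in auto)
  then have 1: "log 2 (real P) \<le> log 2 (real m ^ m)"
    using P0 assms by (simp flip: of_nat_power)
  have "m ^ m \<le> (\<Sum>k\<le>m. P)" unfolding ex P_def
    by (intro sum_mono binomial_term_le) (use assms in auto)
  then have "m ^ m \<le> (m + 1) * P" by simp
  then have "real m ^ m \<le> (real m + 1) * real P"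
    by (metis (mono_tags) of_nat_1 of_nat_add of_nat_le_iff of_nat_mult of_nat_power)
  then have "log 2 (real m ^ m) \<le> log 2 ((real m + 1) * real P)"
    using assms P0 by simp
  also have "\<dots> = log 2 (real m + 1) + log 2 (real P)"
    using P0 by (intro log_mult_pos) auto
  finally have 2: "log 2 (real m ^ m) \<le> log 2 (real m + 1) + log 2 (real P)" .
  have c0: "m choose r > 0" using assms by simp
  have 3: "log 2 (real P) = log 2 (real (m choose r)) + log 2 (real r ^ r) + log 2 (real (m - r) ^ (m - r))"
  proof -
    have "real r ^ r > 0" "real (m - r) ^ (m - r) > 0" by (cases "r = 0"; simp) (cases "m - r = 0"; simp)
    moreover have "log 2 (a * b * c) = log 2 a + log 2 b + log 2 c" if "a > 0" "b > 0" "c > 0" for a b c :: real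
      using that by (simp add: log_mult_pos)
    ultimately show ?thesis
      unfolding P_def of_nat_mult of_nat_power using c0 by (metis of_nat_0_less_iff)
  qed
  \<comment> \<open>The logarithm of the quotient splits only for a positive numerator; otherwise
    the outer factor is \<open>0\<close> and both sides vanish. The same holds for
    \<open>B\<close>.\<close>
  have A: "real r * log 2 (real r / real m) = real r * log 2 r - real r * log 2 m"
    using assms by (cases "r = 0") (simp_all add: log_divide_pos algebra_simps)
  have B: "(real m - real r) * log 2 ((real m - real r) / real m) 
      = (real m - real r) * log 2 (real m - real r) - (real m - real r) * log 2 m"
    using assms by (cases "r = m") (simp_all add: log_divide_pos algebra_simps)
  have "1 - real r / real m = (real m - real r) / real m"
    using assms by (simp add: field_simps)
  then have "real m * binary_entropy (real r / real m)
      = - (real r * log 2 (real r / real m)) - (real m - real r) * log 2 ((real m - real r) / real m)"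
    using assms by (simp add: binary_entropy_def field_simps)
  also have "\<dots> = real m * log 2 m - real r * log 2 r - (real m - real r) * log 2 (real m - real r)"
    unfolding A B by (simp add: algebra_simps)
  also have "\<dots> = log 2 (real m ^ m) - log 2 (real r ^ r) - log 2 (real (m - r) ^ (m - r))"
    using assms log_power_self[of m] log_power_self[of r] log_power_self[of "m - r"]
    by (simp add: of_nat_diff)
  finally show ?thesis using 1 2 3 by linarith
qed

text \<open>The delicate point is \<open>0\<close>, which is needed for \<open>\<rho> = 0\<close>:
  there \<open>x * log 2 x\<close> tends to \<open>0\<close>, which is also its value.\<close>

lemma continuous_on_binary_entropy: "continuous_on {0..<1} binary_entropy"
proof -
  have "continuous (at x within {0..}) (\<lambda>x. x * log 2 x)" if "x \<ge> 0" for x :: real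
  proof (cases "x = 0")
    case True
    have "((\<lambda>x::real. x * log 2 x) \<longlongrightarrow> 0) (at_right 0)" by real_asymp
    then show ?thesis using True by (simp add: continuous_within at_within_Ici_at_right)
  next
    case False
    then show ?thesis using that
      unfolding continuous_within by (intro tendsto_intros) auto
  qed
  then have xlogx: "continuous_on {0..} (\<lambda>x::real. x * log 2 x)"
    by (simp add: continuous_on_eq_continuous_within)
  have "continuous_on {0..<1} (\<lambda>x::real. - (x * log 2 x) - (1 - x) * log 2 (1 - x))"
    by (intro continuous_intros continuous_on_subset[OF xlogx]
        continuous_on_compose2[OF xlogx, of _ "\<lambda>x. 1 - x"]) auto
  then show ?thesis by (simp add: binary_entropy_def[abs_def])
qed

text \<open>Deleting a fixed number \<open>u\<close> of coordinates changes neither the limit of the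
  ratio nor the exponential rate. The case \<open>u = 0\<close> serves the lower bound on codes,
  \<open>u = l * K\<close> the upper bound.\<close>

lemma tendsto_log_binomial:
  fixes r :: "nat \<Rightarrow> nat"
  assumes \<rho>: "0 \<le> \<rho>" "\<rho> < 1" and r: "(\<lambda>n. real (r n) / real n) \<longlonglongrightarrow> \<rho>"
  shows "(\<lambda>n. log 2 (real ((n - u) choose r n)) / real n) \<longlonglongrightarrow> binary_entropy \<rho>"
proof -
  have quot: "(\<lambda>n. real (n - u) / real n) \<longlonglongrightarrow> 1"
  proof -
    have "(\<lambda>n. (real n - real u) / real n) \<longlonglongrightarrow> 1" by real_asymp
    moreover have "\<forall>\<^sub>F n in sequentially. (real n - real u) / real n = real (n - u) / real n"
      using eventually_ge_at_top[of u] by eventually_elim (simp add: of_nat_diff)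
    ultimately show ?thesis by (rule Lim_transform_eventually)
  qed
  have ratio: "(\<lambda>n. real (r n) / real (n - u)) \<longlonglongrightarrow> \<rho>"
  proof -
    have "(\<lambda>n. (real (r n) / real n) / (real (n - u) / real n)) \<longlonglongrightarrow> \<rho> / 1"
      by (intro tendsto_divide r quot) simp
    moreover have "\<forall>\<^sub>F n in sequentially.
        (real (r n) / real n) / (real (n - u) / real n) = real (r n) / real (n - u)"
      using eventually_gt_at_top[of 0] by eventually_elim simp
    ultimately have "(\<lambda>n. real (r n) / real (n - u)) \<longlonglongrightarrow> \<rho> / 1"
      by (rule Lim_transform_eventually)
    then show ?thesis by simp
  qed
  \<comment> \<open>Eventually \<open>r n < n - u\<close>, which keeps the ratio in the domain of
    continuity and makes the binomial bounds applicable.\<close>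
  have lt: "\<forall>\<^sub>F n in sequentially. real (r n) / real (n - u) < 1"
    using order_tendstoD(2)[OF ratio] \<rho> by blast
  have ent: "(\<lambda>n. binary_entropy (real (r n) / real (n - u))) \<longlonglongrightarrow> binary_entropy \<rho>"
  proof (rule continuous_on_tendsto_compose[OF continuous_on_binary_entropy ratio])
    show "\<forall>\<^sub>F n in sequentially. real (r n) / real (n - u) \<in> {0..<1}"
      using lt by eventually_elim simp
  qed (use \<rho> in auto)
  have main: "(\<lambda>n. real (n - u) / real n * binary_entropy (real (r n) / real (n - u)))
      \<longlonglongrightarrow> 1 * binary_entropy \<rho>"
    by (intro tendsto_mult quot ent)
  have err: "(\<lambda>n. log 2 (real (n - u) + 1) / real n) \<longlonglongrightarrow> 0"
  proof (rule tendsto_sandwich[where f = "\<lambda>_. 0" and h = "\<lambda>n. log 2 (real n + 1) / real n"])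
    show "(\<lambda>n. log 2 (real n + 1) / real n) \<longlonglongrightarrow> 0" by real_asymp
  qed (auto intro!: always_eventually divide_right_mono)
  have "(\<lambda>n. log 2 (real ((n - u) choose r n)) / real n
      - real (n - u) / real n * binary_entropy (real (r n) / real (n - u))) \<longlonglongrightarrow> 0"
  proof (rule tendsto_0_le[OF err])
    show "\<forall>\<^sub>F n in sequentially. norm (log 2 (real ((n - u) choose r n)) / real n
      - real (n - u) / real n * binary_entropy (real (r n) / real (n - u)))
      \<le> norm (log 2 (real (n - u) + 1) / real n) * 1"
      using lt eventually_gt_at_top[of u]
    proof eventually_elim
      case (elim n)
      then have le: "r n \<le> n - u" "n - u > 0" by (auto simp: field_simps)
      have "norm (log 2 (real ((n - u) choose r n)) / real n
          - real (n - u) / real n * binary_entropy (real (r n) / real (n - u)))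
        = \<bar>log 2 (real ((n - u) choose r n)) - real (n - u) * binary_entropy (real (r n) / real (n - u))\<bar> / real n"
        by (simp add: abs_divide flip: diff_divide_distrib)
      also have "\<dots> \<le> log 2 (real (n - u) + 1) / real n"
        by (intro divide_right_mono log_binomial_bounds le) simp
      also have "\<dots> \<le> norm (log 2 (real (n - u) + 1) / real n) * 1" by simp
      finally show ?case .
    qed
  qed
  from tendsto_add[OF this main] show ?thesis by simp
qed

section \<open>Hamming balls\<close>

text \<open>The support of the sum of \<open>x\<close> and \<open>y\<close> over the two-element
  field; it turns distances into cardinalities of coordinate sets.\<close>

definition diff_set :: "bool list \<Rightarrow> bool list \<Rightarrow> nat set" where
  "diff_set x y = {i. i < length x \<and> x ! i \<noteq> y ! i}"

text \<open>Inequality of truth values is exclusive or, so this adds the indicator vector of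
  \<open>S\<close> to \<open>x\<close>.\<close>

definition flip_on :: "bool list \<Rightarrow> nat set \<Rightarrow> bool list" where
  "flip_on x S = map (\<lambda>i. (x ! i) \<noteq> (i \<in> S)) [0..<length x]"

lemma hamming_dist_eq: "hamming_dist x y = card (diff_set x y)"
  by (simp add: hamming_dist_def diff_set_def)

lemma finite_cube: "finite (cube n)" and card_cube: "card (cube n) = 2 ^ n"
  using finite_lists_length_eq[of "UNIV :: bool set" n] card_lists_length_eq[of "UNIV :: bool set" n]
  by (simp_all add: cube_def)

lemma cube_ne: "cube n \<noteq> {}"
  using card_cube[of n] by force

lemma flip_on_in_cube: "x \<in> cube n \<Longrightarrow> flip_on x S \<in> cube n"
  by (simp add: flip_on_def cube_def)

lemma diff_set_subset: "x \<in> cube n \<Longrightarrow> diff_set x y \<subseteq> {..<n}"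
  by (auto simp: diff_set_def cube_def)

text \<open>The support of a sum is the symmetric difference of the supports. Taking
  \<open>y = x\<close> shows that \<open>diff_set x\<close> inverts
  \<open>flip_on x\<close>.\<close>

lemma diff_set_flip_on:
  assumes "x \<in> cube n" "y \<in> cube n" "S \<subseteq> {..<n}"
  shows "diff_set y (flip_on x S) = (S - diff_set x y) \<union> (diff_set x y - S)"
proof (rule set_eqI)
  fix i
  show "i \<in> diff_set y (flip_on x S) \<longleftrightarrow> i \<in> (S - diff_set x y) \<union> (diff_set x y - S)"
    using assms by (cases "i < n") (auto simp: diff_set_def flip_on_def cube_def)
qed

lemma diff_set_self: "diff_set x x = {}"
  by (simp add: diff_set_def)

lemma diff_set_ne: "x \<in> cube n \<Longrightarrow> y \<in> cube n \<Longrightarrow> x \<noteq> y \<Longrightarrow> diff_set x y \<noteq> {}"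
  by (auto simp: diff_set_def cube_def list_eq_iff_nth_eq)

lemma inj_on_flip_on: "x \<in> cube n \<Longrightarrow> inj_on (flip_on x) (Pow {..<n})"
  by (rule inj_on_inverseI[where g = "diff_set x"])
    (simp add: diff_set_flip_on diff_set_self)

lemma flip_on_diff_set: "x \<in> cube n \<Longrightarrow> y \<in> cube n \<Longrightarrow> flip_on x (diff_set x y) = y"
  by (auto simp: diff_set_def flip_on_def cube_def intro!: nth_equalityI)

lemma diff_set_commute: "length x = length y \<Longrightarrow> diff_set x y = diff_set y x"
  by (auto simp: diff_set_def)

lemma mem_hamming_ball_commute:
  "x \<in> cube n \<Longrightarrow> y \<in> cube n \<Longrightarrow> y \<in> hamming_ball n r x \<longleftrightarrow> x \<in> hamming_ball n r y"
  using diff_set_commute[of x y] by (simp add: hamming_ball_def hamming_dist_eq cube_def)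

section \<open>Lower bound by sphere covering\<close>

text \<open>A ball is a union of \<open>r + 1\<close> spheres, and for \<open>2 * r \<le> n\<close>
  the outermost one is the largest.\<close>

lemma card_hamming_ball_le:
  assumes x: "x \<in> cube n" and r: "2 * r \<le> n"
  shows "card (hamming_ball n r x) \<le> (n + 1) * (n choose r)"
proof -
  have "hamming_ball n r x \<subseteq> flip_on x ` (\<Union>k\<le>r. {S. S \<subseteq> {..<n} \<and> card S = k})"
  proof
    fix y assume "y \<in> hamming_ball n r x"
    then have "y = flip_on x (diff_set x y)" "diff_set x y \<subseteq> {..<n}" "card (diff_set x y) \<le> r"
      using x flip_on_diff_set[of x n y] diff_set_subset[of x n y]
      by (auto simp: hamming_ball_def hamming_dist_eq)
    then show "y \<in> flip_on x ` (\<Union>k\<le>r. {S. S \<subseteq> {..<n} \<and> card S = k})" by blast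
  qed
  then have "card (hamming_ball n r x) \<le> card (\<Union>k\<le>r. {S. S \<subseteq> {..<n} \<and> card S = k})"
    by (rule surj_card_le[rotated]) simp
  also have "\<dots> \<le> (\<Sum>k\<le>r. card {S. S \<subseteq> {..<n} \<and> card S = k})" by (rule card_UN_le) simp
  also have "\<dots> = (\<Sum>k\<le>r. n choose k)" by (simp add: n_subsets)
  also have "\<dots> \<le> (\<Sum>k\<le>r. n choose r)" using r by (intro sum_mono binomial_mono) auto
  also have "\<dots> \<le> (n + 1) * (n choose r)" using r by simp
  finally show ?thesis .
qed

text \<open>Since \<open>l \<ge> 1\<close>, the code separates \<open>{x}\<close> from
  \<open>{}\<close>, so every \<open>x\<close> has a codeword within distance \<open>r\<close>; the
  balls around codewords therefore cover the cube.\<close>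

lemma identifying_card_ge:
  assumes C: "identifying n r l C" and l: "l \<ge> 1" and r: "2 * r \<le> n"
  shows "2 ^ n \<le> card C * ((n + 1) * (n choose r))"
proof -
  have sub: "C \<subseteq> cube n" using C by (simp add: identifying_def is_code_def)
  have finC: "finite C" using sub finite_cube finite_subset by blast
  have "cube n \<subseteq> (\<Union>c\<in>C. hamming_ball n r c)"
  proof
    fix x assume x: "x \<in> cube n"
    then have "I_set n r C {x} \<noteq> I_set n r C {}"
      using C l unfolding identifying_def by auto
    then obtain c where "c \<in> C" "c \<in> hamming_ball n r x" 
      by (auto simp: I_set_def hamming_nbhd_def)
    then show "x \<in> (\<Union>c\<in>C. hamming_ball n r c)" 
      using x sub mem_hamming_ball_commute[of x n c r] by blast
  qed
  moreover have "finite (\<Union>c\<in>C. hamming_ball n r c)"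
    using finC finite_cube[of n] by (auto simp: hamming_ball_def)
  ultimately have "card (cube n) \<le> card (\<Union>c\<in>C. hamming_ball n r c)" by (rule card_mono[rotated])
  also have "\<dots> \<le> (\<Sum>c\<in>C. card (hamming_ball n r c))" by (rule card_UN_le[OF finC])
  also have "\<dots> \<le> (\<Sum>c\<in>C. (n + 1) * (n choose r))"
    using sub r by (intro sum_mono card_hamming_ball_le) auto
  finally show ?thesis by (simp add: card_cube)
qed

section \<open>Upper bound by hitting sets\<close>

text \<open>With \<open>T = diff_set x y\<close>, the distance from \<open>y\<close> to
  \<open>flip_on x S\<close> is \<open>card S + card T - 2 * card (S \<inter> T)\<close>, which
  exceeds \<open>r = card S\<close> exactly when \<open>S\<close> contains less than half of
  \<open>T\<close>. Balanced sets \<open>S\<close> thus give points outside all balls around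
  \<open>Y\<close>, and different \<open>S\<close> give different points.\<close>

lemma binomial_le_card_ball_diff:
  fixes \<delta> :: real
  assumes x: "x \<in> cube n" "x \<notin> Y" and Y: "Y \<subseteq> cube n" "card Y \<le> l"
    and \<delta>: "\<delta> > 0" and K: "2 * real l \<le> real K * \<delta>\<^sup>2" and n: "l * K < n"
    and r: "real r \<le> (1 / 2 - \<delta>) * real (n - l * K)"
  shows "real ((n - l * K) choose r) / 2 \<le> real (card (hamming_ball n r x - hamming_nbhd n r Y))"
proof -
  define \<T> where "\<T> = diff_set x ` Y"
  define F where "F = {S. S \<subseteq> {..<n} \<and> card S = r \<and> (\<forall>T\<in>\<T>. 2 * card (S \<inter> T) < card T)}"
  have finY: "finite Y" using Y finite_cube finite_subset by blast
  have "card \<T> \<le> l" using card_image_le[OF finY, of "diff_set x"] Y by (simp add: \<T>_def)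
  moreover have "T \<subseteq> {..<n} \<and> T \<noteq> {}" if "T \<in> \<T>" for T
    using that x Y diff_set_subset diff_set_ne unfolding \<T>_def by blast
  ultimately have "real ((n - l * K) choose r) / 2 \<le> real (card F)"
    unfolding F_def using finY
    by (intro card_balanced_subsets[OF _ _ _ \<delta> K n r]) (auto simp: \<T>_def)
  also have "card F = card (flip_on x ` F)"
    using inj_on_flip_on[OF x(1)] by (intro card_image[symmetric]) (auto simp: F_def elim: inj_on_subset)
  also have "\<dots> \<le> card (hamming_ball n r x - hamming_nbhd n r Y)"
  proof (rule card_mono)
    show "finite (hamming_ball n r x - hamming_nbhd n r Y)"
      using finite_cube[of n] by (auto simp: hamming_ball_def)
    show "flip_on x ` F \<subseteq> hamming_ball n r x - hamming_nbhd n r Y"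
    proof (rule image_subsetI)
      fix S assume S: "S \<in> F"
      then have Sn: "S \<subseteq> {..<n}" "card S = r" "finite S" by (auto simp: F_def finite_subset)
      have "flip_on x S \<in> hamming_ball n r x"
        using x Sn by (simp add: hamming_ball_def hamming_dist_eq flip_on_in_cube diff_set_flip_on diff_set_self)
      moreover have "flip_on x S \<notin> hamming_ball n r y" if y: "y \<in> Y" for y
      proof -
        define T where "T = diff_set x y"
        have yc: "y \<in> cube n" using y Y by auto
        have finT: "finite T" unfolding T_def using diff_set_subset[OF x(1)] finite_subset by blast
        have "2 * card (S \<inter> T) < card T" using S y by (auto simp: F_def \<T>_def T_def)
        moreover have "card (S - T) = card S - card (S \<inter> T)" "card (T - S) = card T - card (S \<inter> T)"
          using Sn finT by (simp_all add: card_Diff_subset_Int Int_commute)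
        moreover have "card (S \<inter> T) \<le> card S" "card (S \<inter> T) \<le> card T"
          using Sn finT by (auto intro: card_mono)
        moreover have "card ((S - T) \<union> (T - S)) = card (S - T) + card (T - S)"
          using Sn finT by (intro card_Un_disjoint) auto
        ultimately have "r < hamming_dist y (flip_on x S)"
          using diff_set_flip_on[OF x(1) yc Sn(1)] Sn(2) by (simp add: hamming_dist_eq T_def)
        then show ?thesis by (simp add: hamming_ball_def)
      qed
      ultimately show "flip_on x S \<in> hamming_ball n r x - hamming_nbhd n r Y"
        by (simp add: hamming_nbhd_def)
    qed
  qed
  finally show ?thesis by simp
qed

text \<open>For \<open>X \<noteq> Y\<close> some \<open>x\<close> lies in one of the two sets but
  not in the other. A codeword in the ball of \<open>x\<close> that avoids the neighbourhood of the
  other set tells them apart.\<close>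

lemma identifying_if_hitting:
  assumes C: "C \<subseteq> cube n" and
    hit: "\<And>x Y. x \<in> cube n \<Longrightarrow> Y \<subseteq> cube n \<Longrightarrow> card Y \<le> l \<Longrightarrow> x \<notin> Y
      \<Longrightarrow> (hamming_ball n r x - hamming_nbhd n r Y) \<inter> C \<noteq> {}"
  shows "identifying n r l C"
  unfolding identifying_def
proof (intro conjI allI impI)
  obtain x where "x \<in> cube n" using cube_ne by blast
  \<comment> \<open>The choice \<open>Y = {}\<close> shows that \<open>C\<close> is
    nonempty.\<close>
  then show "is_code n C" using hit[of x "{}"] C by (auto simp: is_code_def)
next
  fix X Y assume XY: "X \<subseteq> cube n \<and> Y \<subseteq> cube n \<and> card X \<le> l \<and> card Y \<le> l \<and> X \<noteq> Y"
  have *: "I_set n r C X \<noteq> I_set n r C Y"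
    if X: "X \<subseteq> cube n" and Y: "Y \<subseteq> cube n" "card Y \<le> l" and x: "x \<in> X" "x \<notin> Y" for X Y x
  proof -
    obtain c where "c \<in> hamming_ball n r x" "c \<notin> hamming_nbhd n r Y" "c \<in> C"
      using hit[of x Y] X Y x by blast
    then show ?thesis using x by (auto simp: I_set_def hamming_nbhd_def)
  qed
  from XY consider x where "x \<in> X" "x \<notin> Y" | x where "x \<in> Y" "x \<notin> X" by blast
  then show "I_set n r C X \<noteq> I_set n r C Y"
  proof cases
    case 1
    with XY * show ?thesis by blast
  next
    case 2
    with XY *[of Y X] show ?thesis by metis
  qed
qed

text \<open>A crude count suffices: for the cube it is \<open>2 ^ O(n)\<close>, and only its
  logarithm enters the size of the hitting set.\<close>

lemma card_small_subsets:
  assumes A: "finite A" "A \<noteq> {}"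
  shows "finite {Y. Y \<subseteq> A \<and> card Y \<le> l}" "card {Y. Y \<subseteq> A \<and> card Y \<le> l} \<le> (l + 1) * card A ^ l"
proof -
  show "finite {Y. Y \<subseteq> A \<and> card Y \<le> l}" using A by simp
  have "{Y. Y \<subseteq> A \<and> card Y \<le> l} = (\<Union>k\<le>l. {Y. Y \<subseteq> A \<and> card Y = k})" by auto
  then have "card {Y. Y \<subseteq> A \<and> card Y \<le> l} \<le> (\<Sum>k\<le>l. card {Y. Y \<subseteq> A \<and> card Y = k})"
    using card_UN_le[of "{..l}" "\<lambda>k. {Y. Y \<subseteq> A \<and> card Y = k}"] by simp
  also have "\<dots> = (\<Sum>k\<le>l. card A choose k)" using A by (simp add: n_subsets)
  also have "\<dots> \<le> (\<Sum>k\<le>l. card A ^ l)"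
  proof (rule sum_mono)
    fix k assume "k \<in> {..l}"
    have "card A choose k \<le> card A ^ k"
      by (cases "k \<le> card A") (auto intro: binomial_le_pow simp: binomial_eq_0)
    also have "\<dots> \<le> card A ^ l"
      using A \<open>k \<in> {..l}\<close> by (intro power_increasing) (auto simp: Suc_le_eq card_gt_0_iff)
    finally show "card A choose k \<le> card A ^ l" .
  qed
  finally show "card {Y. Y \<subseteq> A \<and> card Y \<le> l} \<le> (l + 1) * card A ^ l" by simp
qed

text \<open>A hitting set for all ball differences is wanted. Each has at least \<open>B / 2\<close>
  points, and the logarithm of their number is linear in \<open>n\<close>, so beyond the ratio
  \<open>2 ^ n / B\<close> only a factor linear in \<open>n\<close> is paid.\<close>

lemma identifying_code_exists:
  fixes \<delta> :: real
  assumes \<delta>: "\<delta> > 0" and K: "2 * real l \<le> real K * \<delta>\<^sup>2" and n: "l * K < n"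
    and r: "real r \<le> (1 / 2 - \<delta>) * real (n - l * K)"
  shows "\<exists>C. identifying n r l C \<and>
    real (card C) * real ((n - l * K) choose r) \<le> 2 ^ n * (2 * ((l + 1) * (n + 1)))"
proof -
  define \<Y> where "\<Y> = {Y. Y \<subseteq> cube n \<and> card Y \<le> l}"
  define P where "P = {(x, Y). x \<in> cube n \<and> Y \<in> \<Y> \<and> x \<notin> Y}"
  define \<F> where "\<F> = (\<lambda>(x, Y). hamming_ball n r x - hamming_nbhd n r Y) ` P"
  define B where "B = real ((n - l * K) choose r)"
  have fin\<Y>: "finite \<Y>" and "card \<Y> \<le> (l + 1) * (2 ^ n) ^ l"
    using card_small_subsets[OF finite_cube cube_ne, of n l] by (auto simp: \<Y>_def card_cube)
  have sub: "P \<subseteq> cube n \<times> \<Y>" by (auto simp: P_def)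
  have finP: "finite P" using sub fin\<Y> finite_cube by (meson finite_SigmaI finite_subset)
  have "card \<F> \<le> card P" unfolding \<F>_def by (rule card_image_le[OF finP])
  also have "\<dots> \<le> card (cube n \<times> \<Y>)" using sub fin\<Y> finite_cube by (intro card_mono) auto
  also have "\<dots> \<le> 2 ^ n * ((l + 1) * (2 ^ n) ^ l)"
    using \<open>card \<Y> \<le> _\<close> by (simp add: card_cartesian_product card_cube)
  also have "\<dots> = (l + 1) * (2 ^ n * (2 ^ n) ^ l)" by (simp only: mult_ac)
  also have "2 ^ n * (2 ^ n) ^ l = (2 :: nat) ^ (n * (l + 1))" by (simp flip: power_mult power_add)
  finally have "card \<F> \<le> (l + 1) * 2 ^ (n * (l + 1))" .
  then have cF: "real (card \<F>) \<le> real (l + 1) * 2 ^ (n * (l + 1))"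
    by (metis (mono_tags) of_nat_le_iff of_nat_mult of_nat_numeral of_nat_power)
  have Fne: "\<F> \<noteq> {}"
  proof -
    obtain x where "x \<in> cube n" using cube_ne by blast
    then have "(x, {}) \<in> P" by (simp add: P_def \<Y>_def)
    then show ?thesis by (auto simp: \<F>_def)
  qed
  have rK: "r \<le> n - l * K"
  proof -
    have "(1 / 2 - \<delta>) * real (n - l * K) \<le> 1 * real (n - l * K)"
      using \<delta> by (intro mult_right_mono) auto
    then show ?thesis using r by linarith
  qed
  then have B0: "B > 0" by (simp add: B_def)
  have big: "A \<subseteq> cube n \<and> B / 2 \<le> real (card A)" if "A \<in> \<F>" for A
    using that binomial_le_card_ball_diff[OF _ _ _ _ \<delta> K n r]
    by (auto simp: \<F>_def P_def \<Y>_def B_def hamming_ball_def)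
  have "finite \<F>" using finP by (simp add: \<F>_def)
  from hitting_set_exists[OF finite_cube cube_ne this Fne _ big] B0
  obtain C where C: "C \<subseteq> cube n" "\<forall>A\<in>\<F>. A \<inter> C \<noteq> {}"
    and cC: "real (card C) \<le> 2 ^ n / (B / 2) * (ln (real (card \<F>)) + 1)"
    by (auto simp: card_cube)
  have "identifying n r l C"
  proof (rule identifying_if_hitting[OF C(1)])
    fix x Y assume "x \<in> cube n" "Y \<subseteq> cube n" "card Y \<le> l" "x \<notin> Y"
    then have "hamming_ball n r x - hamming_nbhd n r Y \<in> \<F>"
      by (auto simp: \<F>_def P_def \<Y>_def)
    then show "(hamming_ball n r x - hamming_nbhd n r Y) \<inter> C \<noteq> {}" using C by blast
  qed
  \<comment> \<open>From \<open>ln (l + 1) \<le> l\<close> and \<open>ln 2 < 1\<close> the left side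
    is at most \<open>l + n * (l + 1) + 1\<close>, which equals the right side.\<close>
  moreover have "ln (real (card \<F>)) + 1 \<le> (l + 1) * (n + 1)"
  proof -
    have "0 < real (card \<F>)" using Fne \<open>finite \<F>\<close> by (simp add: card_gt_0_iff)
    then have "ln (real (card \<F>)) \<le> ln (real (l + 1) * 2 ^ (n * (l + 1)))"
      using cF by simp
    also have "\<dots> = ln (real (l + 1)) + real (n * (l + 1)) * ln 2"
      by (simp add: ln_mult_pos ln_realpow del: of_nat_add)
    also have "\<dots> \<le> real l + real (n * (l + 1)) * 1"
      using ln_add_one_self_le_self[of "real l"] ln_2_less_1
      by (intro add_mono mult_left_mono) (auto simp: add_ac)
    finally show ?thesis by (simp add: algebra_simps)
  qed
  then have "2 ^ n / (B / 2) * (ln (real (card \<F>)) + 1) \<le> 2 ^ n / (B / 2) * ((l + 1) * (n + 1))"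
    using B0 by (intro mult_left_mono) auto
  with cC have "real (card C) \<le> 2 ^ n / (B / 2) * ((l + 1) * (n + 1))" by linarith
  then have "real (card C) * B \<le> 2 ^ n * (2 * ((l + 1) * (n + 1)))"
    using B0 by (simp add: field_simps)
  ultimately show ?thesis unfolding B_def by blast
qed

section \<open>Passage to the limit\<close>

text \<open>\<open>LEAST\<close> picks a genuine minimum only when some code exists, hence the
  hypothesis.\<close>

lemma min_identifying_attained:
  assumes "identifying n r l C"
  obtains C' where "identifying n r l C'" "card C' = min_identifying n r l"
    "min_identifying n r l \<le> card C"
proof -
  have ex: "\<exists>C'. identifying n r l C' \<and> card C' = card C" using assms by blast
  show ?thesis
    using LeastI[of "\<lambda>m. \<exists>C. identifying n r l C \<and> card C = m", OF ex]
      Least_le[of "\<lambda>m. \<exists>C. identifying n r l C \<and> card C = m", OF ex] that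
    unfolding min_identifying_def by blast
qed

theorem theorem1:
  fixes l :: nat and \<rho> :: real and r :: "nat \<Rightarrow> nat"
  assumes "l \<ge> 1"
    and "0 \<le> \<rho>" and "\<rho> < 1 / 2"
    and "(\<lambda>n. real (r n) / real n) \<longlonglongrightarrow> \<rho>"
  shows "(\<forall>\<^sub>F n in sequentially. \<exists>C. identifying n (r n) l C) \<and>
         (\<lambda>n. log 2 (real (min_identifying n (r n) l)) / real n) \<longlonglongrightarrow> 1 - binary_entropy \<rho>"
proof -
  \<comment> \<open>Half the distance from \<open>\<rho>\<close> to \<open>1 / 2\<close>; the other
    half is slack for the convergence of \<open>r n / n\<close> and for the deleted
    coordinates.\<close>
  define \<delta> where "\<delta> = (1 / 2 - \<rho>) / 2"
  have \<delta>: "\<delta> > 0" "\<rho> < 1 / 2 - \<delta>" using assms by (auto simp: \<delta>_def field_simps)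
  \<comment> \<open>The least natural number that meets the Chebyshev requirement
    \<open>2 * l \<le> K * \<delta>\<^sup>2\<close>. It does not depend on \<open>n\<close>, so
    \<open>u = l * K\<close> is a constant.\<close>
  define K where "K = nat \<lceil>2 * real l / \<delta>\<^sup>2\<rceil>"
  have "2 * real l / \<delta>\<^sup>2 \<le> real K" unfolding K_def by linarith
  then have K: "2 * real l \<le> real K * \<delta>\<^sup>2" using \<delta> by (simp add: field_simps)
  define u where "u = l * K"
  define M where "M n = min_identifying n (r n) l" for n
  have \<rho>: "0 \<le> \<rho>" "\<rho> < 1" using assms by auto
  \<comment> \<open>After division by \<open>n\<close>, the deleted coordinates contribute only
    \<open>(1 / 2 - \<delta>) * u / n\<close>, which tends to \<open>0\<close>.\<close>
  have small: "\<forall>\<^sub>F n in sequentially. real (r n) \<le> (1 / 2 - \<delta>) * real (n - u)"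
  proof -
    have "(\<lambda>n. real (r n) / real n + (1 / 2 - \<delta>) * (real u / real n)) \<longlonglongrightarrow> \<rho> + (1 / 2 - \<delta>) * 0"
      by (intro tendsto_add tendsto_mult tendsto_const assms) real_asymp
    then have "\<forall>\<^sub>F n in sequentially. real (r n) / real n + (1 / 2 - \<delta>) * (real u / real n) < 1 / 2 - \<delta>"
      using \<delta> by (intro order_tendstoD(2)) auto
    then show ?thesis
      using eventually_gt_at_top[of u]
    proof eventually_elim
      case (elim n)
      then have "(real (r n) / real n + (1 / 2 - \<delta>) * (real u / real n)) * real n \<le> (1 / 2 - \<delta>) * real n"
        by (intro mult_right_mono) auto
      moreover have "(real (r n) / real n + (1 / 2 - \<delta>) * (real u / real n)) * real n
          = real (r n) + (1 / 2 - \<delta>) * real u"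
        using elim by (simp add: field_simps)
      moreover have "(1 / 2 - \<delta>) * real (n - u) = (1 / 2 - \<delta>) * real n - (1 / 2 - \<delta>) * real u"
        using elim by (simp add: of_nat_diff right_diff_distrib)
      ultimately show ?case by linarith
    qed
  qed
  \<comment> \<open>The two sides of the squeeze. The form \<open>(n - 0) choose r n\<close> matches
    \<open>tendsto_log_binomial\<close> with \<open>u = 0\<close>.\<close>
  have ev: "\<forall>\<^sub>F n in sequentially. (\<exists>C. identifying n (r n) l C) \<and>
      1 - log 2 (real n + 1) / real n - log 2 (real ((n - 0) choose r n)) / real n \<le> log 2 (real (M n)) / real n \<and>
      log 2 (real (M n)) / real n
        \<le> 1 + log 2 (2 * ((real l + 1) * (real n + 1))) / real n - log 2 (real ((n - u) choose r n)) / real n"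
    using small eventually_gt_at_top[of u]
  proof eventually_elim
    case (elim n)
    have n0: "real n > 0" using elim by simp
    have "(1 / 2 - \<delta>) * real (n - u) \<le> 1 / 2 * real (n - u)"
      using \<delta> by (intro mult_right_mono) auto
    \<comment> \<open>This gives both the hypothesis \<open>2 * r \<le> n\<close> of the sphere
      covering bound and the positivity of the binomial coefficients whose logarithms are
      taken.\<close>
    then have r2: "2 * r n \<le> n - u" using elim by linarith
    from identifying_code_exists[OF \<delta>(1) K, of n "r n"] elim
    obtain C where C: "identifying n (r n) l C"
      and up: "real (card C) * real ((n - u) choose r n) \<le> 2 ^ n * (2 * ((real l + 1) * (real n + 1)))"
      by (auto simp: u_def algebra_simps)
    obtain C' where C': "identifying n (r n) l C'" "card C' = M n" "M n \<le> card C"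
      using min_identifying_attained[OF C] unfolding M_def by metis
    have lo: "2 ^ n \<le> M n * ((n + 1) * (n choose r n))"
      using identifying_card_ge[OF C'(1) assms(1)] r2 C' by simp
    \<comment> \<open>The covering bound has a positive left side, so \<open>M n\<close> cannot be
      \<open>0\<close> and its logarithm is meaningful.\<close>
    have M0: "M n > 0" using lo by (cases "M n") auto
    have c0: "n choose r n > 0" "(n - u) choose r n > 0" using r2 by simp_all
    have "2 ^ n \<le> real (M n) * ((real n + 1) * real (n choose r n))"
      using lo by (metis (mono_tags) of_nat_1 of_nat_add of_nat_le_iff of_nat_mult of_nat_numeral of_nat_power)
    then have "log 2 (2 ^ n) \<le> log 2 (real (M n) * ((real n + 1) * real (n choose r n)))"
      using M0 c0 by (intro log_mono) auto
    also have "\<dots> = log 2 (real (M n)) + (log 2 (real n + 1) + log 2 (real (n choose r n)))"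
      using M0 c0 by (simp add: log_mult_pos)
    finally have 1: "real n \<le> log 2 (real (M n)) + (log 2 (real n + 1) + log 2 (real (n choose r n)))"
      by simp
    have "real (M n) * real ((n - u) choose r n) \<le> real (card C) * real ((n - u) choose r n)"
      using C' by (intro mult_right_mono) auto
    with up have "real (M n) * real ((n - u) choose r n) \<le> 2 ^ n * (2 * ((real l + 1) * (real n + 1)))"
      by linarith
    then have "log 2 (real (M n) * real ((n - u) choose r n)) \<le> log 2 (2 ^ n * (2 * ((real l + 1) * (real n + 1))))"
      using M0 c0 by (intro log_mono) auto
    then have 2: "log 2 (real (M n)) + log 2 (real ((n - u) choose r n))
        \<le> real n + log 2 (2 * ((real l + 1) * (real n + 1)))"
      using M0 c0 log_mult_pos[of "2 ^ n" "2 * ((real l + 1) * (real n + 1))" 2] by (simp add: log_mult_pos)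
    have "1 - log 2 (real n + 1) / real n - log 2 (real ((n - 0) choose r n)) / real n \<le> log 2 (real (M n)) / real n"
      using divide_right_mono[OF 1, of "real n"] n0 by (simp add: add_divide_distrib)
    moreover have "log 2 (real (M n)) / real n
        \<le> 1 + log 2 (2 * ((real l + 1) * (real n + 1))) / real n - log 2 (real ((n - u) choose r n)) / real n"
      using divide_right_mono[OF 2, of "real n"] n0 by (simp add: add_divide_distrib)
    ultimately show ?case using C by blast
  qed
  have "(\<lambda>n. log 2 (real (M n)) / real n) \<longlonglongrightarrow> 1 - binary_entropy \<rho>"
  proof (rule tendsto_sandwich)
    have "(\<lambda>n. log 2 (real n + 1) / real n) \<longlonglongrightarrow> 0" by real_asymp
    then have "(\<lambda>n. 1 - log 2 (real n + 1) / real n - log 2 (real ((n - 0) choose r n)) / real n)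
        \<longlonglongrightarrow> 1 - 0 - binary_entropy \<rho>"
      by (intro tendsto_diff tendsto_const tendsto_log_binomial \<rho> assms(4))
    then show "(\<lambda>n. 1 - log 2 (real n + 1) / real n - log 2 (real ((n - 0) choose r n)) / real n)
        \<longlonglongrightarrow> 1 - binary_entropy \<rho>" by simp
    have "(\<lambda>n. log 2 (2 * ((real l + 1) * (real n + 1))) / real n) \<longlonglongrightarrow> 0" by real_asymp
    then have "(\<lambda>n. 1 + log 2 (2 * ((real l + 1) * (real n + 1))) / real n - log 2 (real ((n - u) choose r n)) / real n)
        \<longlonglongrightarrow> 1 + 0 - binary_entropy \<rho>"
      by (intro tendsto_diff tendsto_add tendsto_const tendsto_log_binomial \<rho> assms(4))
    then show "(\<lambda>n. 1 + log 2 (2 * ((real l + 1) * (real n + 1))) / real n - log 2 (real ((n - u) choose r n)) / real n)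
        \<longlonglongrightarrow> 1 - binary_entropy \<rho>" by simp
  qed (use ev in \<open>auto elim: eventually_mono\<close>)
  moreover have "\<forall>\<^sub>F n in sequentially. \<exists>C. identifying n (r n) l C"
    using ev by (rule eventually_mono) blast
  ultimately show ?thesis unfolding M_def by blast
qed

end
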